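(* For Online Makespan Scheduling under Scenarios with $m=2$ machines and $K=2$ scenarios, there exists no deterministic online algorithm with competitive ratio strictly smaller than $\frac{9+\sqrt{17}}{8}$.
   Context: Online Makespan Scheduling under Scenarios with $m$ machines and $K$ scenarios (both known in advance): an instance consists of $n$ jobs with processing times $p_j\ge0$ and scenarios $S_1,\dots,S_K\subseteq[n]$ (not known in advance); jobs are revealed in order $1,\dots,n$, and on revelation of job $j$ the algorithm learns $p_j$ and which scenarios contain $j$, and must irrevocably assign $j$ to a machine $\tau(j)\in[m]$. With $J_i=\tau^{-1}(i)$ and $p(S)=\sum_{j\in S}p_j$, the makespan is $\max_{k}\max_i p(J_i\cap S_k)$; the competitive ratio of an algorithm is the supremum over instances of its makespan divided by the offline optimum (minimum makespan over all partitions of $[n]$ into $m$ machines). *)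

theory Defs
  imports Complex_Main "HOL-Library.Extended_Real" "HOL-Library.FuncSet"
begin

text \<open>Jobs, machines and scenarios are numbered from 1: job \<open>j\<close> ranges over \<open>{1..n}\<close>,
  machine \<open>i\<close> over \<open>{1..m}\<close>, scenario \<open>k\<close> over \<open>{1..K}\<close>.
  Values of \<open>ptime\<close> and \<open>scenario\<close> outside these ranges are irrelevant.\<close>

record sched_instance =
  njobs :: nat
  ptime :: "nat \<Rightarrow> real"
  scenario :: "nat \<Rightarrow> nat set"

definition valid_instance :: "nat \<Rightarrow> sched_instance \<Rightarrow> bool" where
  "valid_instance K I \<longleftrightarrow>
     (\<forall>j\<in>{1..njobs I}. 0 \<le> ptime I j) \<and> (\<forall>k\<in>{1..K}. scenario I k \<subseteq> {1..njobs I})"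

definition makespan :: "nat \<Rightarrow> nat \<Rightarrow> sched_instance \<Rightarrow> (nat \<Rightarrow> nat) \<Rightarrow> real" where
  "makespan m K I \<tau> =
     (MAX k\<in>{1..K}. MAX i\<in>{1..m}. \<Sum>j\<in>{j\<in>{1..njobs I}. \<tau> j = i} \<inter> scenario I k. ptime I j)"

definition opt_makespan :: "nat \<Rightarrow> nat \<Rightarrow> sched_instance \<Rightarrow> real" where
  "opt_makespan m K I = (MIN \<tau>\<in>{1..njobs I} \<rightarrow>\<^sub>E {1..m}. makespan m K I \<tau>)"

type_synonym job_info = "real \<times> nat set"

definition job_info :: "nat \<Rightarrow> sched_instance \<Rightarrow> nat \<Rightarrow> job_info" where
  "job_info K I j = (ptime I j, {k\<in>{1..K}. j \<in> scenario I k})"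

text \<open>A deterministic online algorithm maps the information on the jobs revealed so far, the
  current job being last in the list, to the machine of the current job. Its own earlier decisions
  are functions of the same list and need not be passed separately; the total number of jobs is
  not available to it.\<close>

type_synonym online_alg = "job_info list \<Rightarrow> nat"

definition assignment :: "nat \<Rightarrow> online_alg \<Rightarrow> sched_instance \<Rightarrow> nat \<Rightarrow> nat" where
  "assignment K A I j = A (map (job_info K I) [1..<Suc j])"

definition online_algorithm :: "nat \<Rightarrow> nat \<Rightarrow> online_alg \<Rightarrow> bool" where
  "online_algorithm m K A \<longleftrightarrow>
     (\<forall>I. valid_instance K I \<longrightarrow> (\<forall>j\<in>{1..njobs I}. assignment K A I j \<in> {1..m}))"

text \<open>If the optimum is 0, every job of positive length lies in no scenario, so every assignment
  has makespan 0. Such instances contribute \<open>0 / 0 = 0\<close>, which does not affect the supremum.\<close>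

definition competitive_ratio :: "nat \<Rightarrow> nat \<Rightarrow> online_alg \<Rightarrow> ereal" where
  "competitive_ratio m K A =
     (SUP I\<in>{I. valid_instance K I}.
        ereal (makespan m K I (assignment K A I) / opt_makespan m K I))"

end

theory Submission
  imports Defs
begin

text \<open>
  Put \<open>c = (9 + sqrt 17) / 8\<close>, \<open>y = 3 + sqrt 17\<close>, \<open>x = y / 2\<close> and \<open>u = 2 + 3 y / 2\<close>, so that
  \<open>c y = 1 + x + y\<close> and \<open>c u = 1 + y + u\<close>. The adversary releases two jobs of length 1 in both
  scenarios, which an algorithm of ratio below \<open>c\<close> has to separate, then a job of length \<open>x\<close> in
  scenario 2 and a job of length \<open>y\<close> in scenario 1.

  If the last two jobs share a machine, the adversary releases a job of length \<open>y\<close> in scenario 2.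
  The optimum is then at most \<open>y\<close>, and putting this job on the same machine again yields the load
  \<open>1 + x + y\<close>. If the two jobs are separated, the adversary releases a job of length \<open>x\<close> in both
  scenarios. The optimum is again at most \<open>y\<close>, and putting this job on the machine of the job
  of length \<open>y\<close> yields the load \<open>1 + x + y\<close>.

  In either case both machines now have load \<open>1 + y\<close> in some scenario, and all jobs together have
  length at most \<open>u\<close> in each scenario. A job of length \<open>u\<close> in both scenarios then forces the load
  \<open>1 + y + u\<close>, while the optimum is at most \<open>u\<close>.
\<close>

text \<open>The adversary's job sequences are lists of what the algorithm gets to see;
  \<open>j - 1\<close> converts jobs, numbered from 1, to list positions.\<close>

definition list_instance :: "job_info list \<Rightarrow> sched_instance" where
  "list_instance L = \<lparr>njobs = length L, ptime = (\<lambda>j. fst (L ! (j - 1))),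
     scenario = (\<lambda>k. {j\<in>{1..length L}. k \<in> snd (L ! (j - 1))})\<rparr>"

text \<open>\<open>M\<close> lists the machines of the jobs in \<open>L\<close>. The list form lets
  \<open>simp\<close> compute the loads of concrete sequences through
  \<open>load_Cons\<close>.\<close>

definition load :: "job_info list \<Rightarrow> nat list \<Rightarrow> nat \<Rightarrow> nat \<Rightarrow> real" where
  "load L M k i = (\<Sum>(x, t)\<leftarrow>zip L M. if t = i \<and> k \<in> snd x then fst x else 0)"

text \<open>Job \<open>j\<close> is answered from the prefix \<open>take j L\<close> alone, so
  appending jobs leaves earlier answers unchanged. This lets the adversary adapt to them.\<close>

definition responses :: "online_alg \<Rightarrow> job_info list \<Rightarrow> nat list" where
  "responses A L = map (\<lambda>j. A (take j L)) [1..<Suc (length L)]"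

lemma valid_list_instance:
  assumes "\<And>x. x \<in> set L \<Longrightarrow> 0 \<le> fst x"
  shows "valid_instance K (list_instance L)"
proof -
  have "0 \<le> fst (L ! (j - 1))" if "j \<in> {1..length L}" for j
    using that by (intro assms nth_mem) auto
  then show ?thesis
    by (auto simp: valid_instance_def list_instance_def)
qed

lemma sum_list_instance_eq_load:
  "(\<Sum>j\<in>{j\<in>{1..njobs (list_instance L)}. \<tau> j = i} \<inter> scenario (list_instance L) k.
      ptime (list_instance L) j) = load L (map \<tau> [1..<Suc (length L)]) k i"
proof -
  let ?n = "length L"
  let ?M = "map \<tau> [1..<Suc ?n]"
  let ?f = "\<lambda>j. if \<tau> j = i \<and> k \<in> snd (L ! (j - 1)) then fst (L ! (j - 1)) else 0"
  have "{j\<in>{1..njobs (list_instance L)}. \<tau> j = i} \<inter> scenario (list_instance L) k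
      = {j\<in>{1..?n}. \<tau> j = i \<and> k \<in> snd (L ! (j - 1))}"
    by (auto simp: list_instance_def)
  then have "(\<Sum>j\<in>{j\<in>{1..njobs (list_instance L)}. \<tau> j = i} \<inter> scenario (list_instance L) k.
      ptime (list_instance L) j) = (\<Sum>j\<in>{1..?n}. ?f j)"
    by (simp only: sum.inter_filter finite_atLeastAtMost)
      (simp add: list_instance_def cong: if_cong)
  also have "\<dots> = (\<Sum>j<?n. ?f (Suc j))"
    by (simp add: sum.atLeast1_atMost_eq)
  also have "\<dots> = load L ?M k i"
    unfolding load_def sum_list_sum_nth atLeast0LessThan
    by (rule sum.cong) (simp_all del: upt_Suc)
  finally show ?thesis .
qed

lemma makespan_list_instance:
  "makespan 2 2 (list_instance L) \<tau> =
     (MAX k\<in>{1, 2}. MAX i\<in>{1, 2}. load L (map \<tau> [1..<Suc (length L)]) k i)"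
proof -
  have "{1..2} = {1, 2 :: nat}"
    by auto
  then show ?thesis
    unfolding makespan_def sum_list_instance_eq_load by simp
qed

text \<open>\<open>job_info\<close> keeps only scenario numbers in \<open>{1..K}\<close>; under the
  hypothesis on \<open>snd\<close> it therefore returns the list entries exactly.\<close>

lemma assignment_list_instance:
  assumes "\<And>x. x \<in> set L \<Longrightarrow> snd x \<subseteq> {1..K}" and "j \<le> length L"
  shows "assignment K A (list_instance L) j = A (take j L)"
proof -
  have "job_info K (list_instance L) (Suc i) = L ! i" if "i < length L" for i
    using that assms(1)[of "L ! i"] by (auto simp: job_info_def list_instance_def prod_eq_iff)
  then have "map (job_info K (list_instance L)) [1..<Suc j] = take j L"
    using assms(2) by (intro nth_equalityI) (auto simp del: upt_Suc)
  then show ?thesis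
    by (simp only: assignment_def)
qed

lemma responses_eq_assignment:
  assumes "\<And>x. x \<in> set L \<Longrightarrow> snd x \<subseteq> {1..K}"
  shows "map (assignment K A (list_instance L)) [1..<Suc (length L)] = responses A L"
  unfolding responses_def using assms
  by (intro map_cong refl assignment_list_instance) auto

lemma load_nonneg:
  assumes "\<And>x. x \<in> set L \<Longrightarrow> 0 \<le> fst x"
  shows "0 \<le> load L M k i"
  unfolding load_def using assms
  by (intro sum_list_nonneg) (auto dest: set_zip_leftD)

lemma load_Nil [simp]: "load [] M k i = 0"
  by (simp add: load_def)

lemma load_Cons [simp]:
  "load (x # L) (t # M) k i = (if t = i \<and> k \<in> snd x then fst x else 0) + load L M k i"
  by (simp add: load_def)

lemma load_le_makespan:
  assumes "k \<in> {1, 2}" "i \<in> {1, 2}"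
  shows "load L (map \<tau> [1..<Suc (length L)]) k i \<le> makespan 2 2 (list_instance L) \<tau>"
  using assms unfolding makespan_list_instance by (auto simp: le_max_iff_disj simp del: upt_Suc)

lemma opt_makespan_le:
  assumes "length M = length L" "set M \<subseteq> {1, 2}"
    and B: "\<And>k i. k \<in> {1, 2} \<Longrightarrow> i \<in> {1, 2} \<Longrightarrow> load L M k i \<le> B"
  shows "opt_makespan 2 2 (list_instance L) \<le> B"
proof -
  let ?n = "length L"
  define \<tau> where "\<tau> = restrict (\<lambda>j. M ! (j - 1)) {1..?n}"
  have "M ! (j - 1) \<in> {1..2}" if "j \<in> {1..?n}" for j
    using that assms(1,2) nth_mem[of "j - 1" M] by fastforce
  then have "\<tau> \<in> {1..njobs (list_instance L)} \<rightarrow>\<^sub>E {1..2}"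
    by (auto simp: \<tau>_def list_instance_def)
  then have "opt_makespan 2 2 (list_instance L) \<le> makespan 2 2 (list_instance L) \<tau>"
    unfolding opt_makespan_def by (intro Min_le finite_imageI finite_PiE imageI) auto
  also have "map \<tau> [1..<Suc ?n] = M"
    using assms(1) by (intro nth_equalityI) (auto simp: \<tau>_def simp del: upt_Suc)
  then have "makespan 2 2 (list_instance L) \<tau> \<le> B"
    unfolding makespan_list_instance by (simp add: B)
  finally show ?thesis .
qed

text \<open>Whichever machine gets the first job has positive load in scenario \<open>k\<close>.
  This excludes a division by 0 in the ratio, whose value 0 would say nothing about the
  makespan.\<close>

lemma opt_makespan_pos:
  assumes "0 < fst x" "k \<in> snd x" "k \<in> {1, 2}" and nonneg: "\<And>x. x \<in> set L \<Longrightarrow> 0 \<le> fst x"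
  shows "0 < opt_makespan 2 2 (list_instance (x # L))"
proof -
  let ?I = "list_instance (x # L)"
  let ?T = "{1..njobs ?I} \<rightarrow>\<^sub>E {1..2 :: nat}"
  have "?T \<noteq> {}" "finite ?T"
    by (auto simp: PiE_eq_empty_iff intro: finite_PiE)
  then have "opt_makespan 2 2 ?I \<in> makespan 2 2 ?I ` ?T"
    unfolding opt_makespan_def by (intro Min_in) auto
  then obtain \<tau> where \<tau>: "\<tau> \<in> ?T" "opt_makespan 2 2 ?I = makespan 2 2 ?I \<tau>"
    by auto
  have "1 \<in> {1..njobs ?I}"
    by (simp add: list_instance_def)
  with \<tau>(1) have "\<tau> 1 \<in> {1..2}"
    by (rule PiE_mem)
  then have "\<tau> 1 \<in> {1, 2}"
    by auto
  have "map \<tau> [1..<Suc (length (x # L))] = \<tau> 1 # map \<tau> [2..<Suc (length (x # L))]"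
    by (simp add: upt_conv_Cons numeral_2_eq_2 del: upt_Suc)
  then have "0 < load (x # L) (map \<tau> [1..<Suc (length (x # L))]) k (\<tau> 1)"
    using assms(1,2) load_nonneg[OF nonneg, of L] by (simp add: add_pos_nonneg del: upt_Suc)
  also have "\<dots> \<le> makespan 2 2 ?I \<tau>"
    using \<open>k \<in> {1, 2}\<close> \<open>\<tau> 1 \<in> {1, 2}\<close> by (rule load_le_makespan)
  finally show ?thesis
    using \<tau>(2) by simp
qed

text \<open>The form in which the ratio is used: one explicit assignment \<open>M\<close> with loads
  at most \<open>B\<close> bounds the optimum by \<open>B\<close>, so a ratio below \<open>c\<close>
  caps every load of the algorithm.\<close>

lemma load_responses_less:
  assumes "competitive_ratio 2 2 A < ereal c" "0 \<le> c"
    and x: "0 < fst x" "k' \<in> snd x" "k' \<in> {1, 2}"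
    and L: "\<And>z. z \<in> set (x # L) \<Longrightarrow> 0 \<le> fst z \<and> snd z \<subseteq> {1, 2}"
    and M: "length M = length (x # L)" "set M \<subseteq> {1, 2}"
      "\<And>k i. k \<in> {1, 2} \<Longrightarrow> i \<in> {1, 2} \<Longrightarrow> load (x # L) M k i \<le> B"
    and "k \<in> {1, 2}" "i \<in> {1, 2}"
  shows "load (x # L) (responses A (x # L)) k i < c * B"
proof -
  let ?I = "list_instance (x # L)"
  let ?\<tau> = "assignment 2 A ?I"
  have "valid_instance 2 ?I"
    using L by (intro valid_list_instance) blast
  then have "ereal (makespan 2 2 ?I ?\<tau> / opt_makespan 2 2 ?I) \<le> competitive_ratio 2 2 A"
    unfolding competitive_ratio_def by (intro SUP_upper) simp
  with assms(1) have "makespan 2 2 ?I ?\<tau> / opt_makespan 2 2 ?I < c"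
    using le_less_trans by fastforce
  moreover have "0 < opt_makespan 2 2 ?I"
    using x L by (intro opt_makespan_pos) auto
  ultimately have "makespan 2 2 ?I ?\<tau> < c * opt_makespan 2 2 ?I"
    by (simp add: divide_less_eq)
  also have "\<dots> \<le> c * B"
    using \<open>0 \<le> c\<close> M by (intro mult_left_mono opt_makespan_le)
  finally have "makespan 2 2 ?I ?\<tau> < c * B" .
  moreover have "{1..2} = {1, 2 :: nat}"
    by auto
  then have "map ?\<tau> [1..<Suc (length (x # L))] = responses A (x # L)"
    using L by (intro responses_eq_assignment) simp
  then have "load (x # L) (responses A (x # L)) k i \<le> makespan 2 2 ?I ?\<tau>"
    using load_le_makespan[OF \<open>k \<in> {1, 2}\<close> \<open>i \<in> {1, 2}\<close>, of "x # L" ?\<tau>] by simp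
  ultimately show ?thesis
    by simp
qed

lemma response_in_machines:
  assumes "online_algorithm m K A" "L \<noteq> []"
    and L: "\<And>z. z \<in> set L \<Longrightarrow> 0 \<le> fst z \<and> snd z \<subseteq> {1..K}"
  shows "A L \<in> {1..m}"
proof -
  have "valid_instance K (list_instance L)"
    using L by (intro valid_list_instance) blast
  moreover have "length L \<in> {1..njobs (list_instance L)}"
    using \<open>L \<noteq> []\<close> by (simp add: list_instance_def Suc_leI)
  ultimately have "assignment K A (list_instance L) (length L) \<in> {1..m}"
    using assms(1) by (simp add: online_algorithm_def)
  then show ?thesis
    using L by (simp add: assignment_list_instance)
qed

theorem mainTheorem7:
  "\<not> (\<exists>A. online_algorithm 2 2 A \<and> competitive_ratio 2 2 A < ereal ((9 + sqrt 17) / 8))"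
proof
  assume "\<exists>A. online_algorithm 2 2 A \<and> competitive_ratio 2 2 A < ereal ((9 + sqrt 17) / 8)"
  then obtain A where A: "online_algorithm 2 2 A"
    and ratio: "competitive_ratio 2 2 A < ereal ((9 + sqrt 17) / 8)"
    by blast
  define c y x u :: real
    where "c = (9 + sqrt 17) / 8" and "y = 3 + sqrt 17" and "x = y / 2" and "u = 2 + 3 * y / 2"
  have "sqrt 17 * sqrt 17 = (17 :: real)"
    by simp
  then have cy: "c * y = 1 + x + y" and cu: "c * u = 1 + y + u"
    unfolding c_def y_def x_def u_def by (simp_all add: field_simps)
  have "4 \<le> sqrt (17 :: real)" "sqrt (17 :: real) < 5"
    by (auto intro: real_le_rsqrt real_less_lsqrt)
  \<comment> \<open>\<open>4 < y\<close> gives \<open>2 + x \<le> y\<close>, which keeps the optimum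
    at most \<open>y\<close> after five jobs in both cases; \<open>c < 2\<close> forces the two unit
    jobs apart.\<close>
  then have y: "4 < y" and c: "0 \<le> c" "c < 2"
    by (simp_all add: y_def c_def)
  define e X Y Z V U :: job_info
    where "e = (1, {1, 2})" and "X = (x, {2})" and "Y = (y, {1})" and "Z = (y, {2})"
      and "V = (x, {1, 2})" and "U = (u, {1, 2})"
  note jobs = e_def X_def Y_def Z_def V_def U_def
  have admissible: "0 \<le> fst z \<and> snd z \<subseteq> {1, 2}" if "z \<in> {e, X, Y, Z, V, U}" for z
    using that y by (auto simp: jobs x_def u_def)
  have upto2: "{1..2} = {1, 2 :: nat}"
    by auto
  have machine: "A L \<in> {1, 2}" if "L \<noteq> []" "set L \<subseteq> {e, X, Y, Z, V, U}" for L
    using response_in_machines[OF A that(1)] admissible that(2) unfolding upto2 by blast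
  have loads: "load (e # L) (responses A (e # L)) k i < c * B"
    if "set L \<subseteq> {e, X, Y, Z, V, U}" "length M = length (e # L)" "set M \<subseteq> {1, 2}"
      "\<And>k i. k \<in> {1, 2} \<Longrightarrow> i \<in> {1, 2} \<Longrightarrow> load (e # L) M k i \<le> B"
      "k \<in> {1, 2}" "i \<in> {1, 2}" for L M B k i
  proof (rule load_responses_less[where k' = 1 and M = M])
    show "competitive_ratio 2 2 A < ereal c"
      using ratio by (simp add: c_def)
    show "0 \<le> fst z \<and> snd z \<subseteq> {1, 2}" if "z \<in> set (e # L)" for z
      using that \<open>set L \<subseteq> _\<close> by (intro admissible) auto
  qed (use that c in \<open>auto simp: e_def\<close>)

  let ?a = "A [e, e, X]" and ?b = "A [e, e, X, Y]"
  have a: "?a \<in> {1, 2}" and b: "?b \<in> {1, 2}"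
    by (rule machine; simp)+
  have "load [e, e] (responses A [e, e]) 1 (A [e]) < c * 1"
    by (rule loads[where M = "[1, 2]"]) (use machine[of "[e]"] in \<open>auto simp: jobs\<close>)
  with c have split: "A [e] \<noteq> A [e, e]"
    by (auto simp: responses_def jobs)
  \<comment> \<open>Each machine holds one unit job, the summand 1 in the loads
    \<open>1 + x + y\<close> and \<open>1 + y + u\<close>.\<close>
  have units: "A [e] = i \<or> A [e, e] = i" if "i \<in> {1, 2}" for i
    using split that machine[of "[e]"] machine[of "[e, e]"] by auto
  show False
  proof (cases "?b = ?a")
    case True
    let ?L = "[e, e, X, Y, Z]"
    \<comment> \<open>In the witness, machine 1 has loads \<open>2\<close> and \<open>2 + x\<close>
      in scenarios 1 and 2, machine 2 has \<open>y\<close> in both.\<close>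
    have "load ?L (responses A ?L) 2 ?a < c * y"
      by (rule loads[where M = "[1, 1, 1, 2, 2]"]) (use a y in \<open>auto simp: jobs x_def\<close>)
    with cy split units[OF a] have Z: "A ?L \<noteq> ?a"
      by (auto simp: responses_def jobs)
    let ?L' = "?L @ [U]"
    \<comment> \<open>The witness sets \<open>U\<close> against all other jobs; \<open>u\<close> is
      the total length of \<open>?L\<close> in scenario 2 and exceeds that in scenario 1.\<close>
    have final: "load ?L' (responses A ?L') k i < c * u" if "k \<in> {1, 2}" "i \<in> {1, 2}" for k i
      unfolding append_Cons
      by (rule loads[where M = "[1, 1, 1, 1, 1, 2]"]) (use that y in \<open>auto simp: jobs x_def u_def\<close>)
    have Zm: "A ?L \<in> {1, 2}" and Um: "A ?L' \<in> {1, 2}"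
      by (rule machine; simp)+
    show False
    \<comment> \<open>Before \<open>U\<close>, machine \<open>?a\<close> has load
      \<open>1 + y\<close> in scenario 1 due to \<open>Y\<close>, the other machine in scenario 2
      due to \<open>Z\<close>.\<close>
    proof (cases "A ?L' = ?a")
      case U: True
      show False
        using final[of 1 ?a] a U True Z cu split units[OF a] by (auto simp: responses_def jobs)
    next
      case False
      then have "A ?L' = A ?L"
        using Z Zm Um a by auto
      then show False
        using final[of 2 "A ?L"] Zm True Z cu split units[OF Zm] by (auto simp: responses_def jobs)
    qed
  next
    case False
    let ?L = "[e, e, X, Y, V]"
    \<comment> \<open>In the witness, machine 1 has load \<open>2 + x\<close> in both scenarios; on
      machine 2, \<open>X\<close> and \<open>Y\<close> lie in different scenarios.\<close>
    have "load ?L (responses A ?L) 1 ?b < c * y"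
      by (rule loads[where M = "[1, 1, 2, 2, 1]"]) (use b y in \<open>auto simp: jobs x_def\<close>)
    with cy split units[OF b] have V: "A ?L \<noteq> ?b"
      by (auto simp: responses_def jobs)
    have Vm: "A ?L \<in> {1, 2}"
      by (rule machine; simp)+
    with V False a b have Va: "A ?L = ?a"
      by auto
    let ?L' = "?L @ [U]"
    have final: "load ?L' (responses A ?L') k i < c * u" if "k \<in> {1, 2}" "i \<in> {1, 2}" for k i
      unfolding append_Cons
      by (rule loads[where M = "[1, 1, 1, 1, 1, 2]"]) (use that y in \<open>auto simp: jobs x_def u_def\<close>)
    have Um: "A ?L' \<in> {1, 2}"
      by (rule machine; simp)+
    \<comment> \<open>In scenario 2, \<open>X\<close> and \<open>V\<close> on \<open>?a\<close> act
      like one job of length \<open>y\<close>, as \<open>Y\<close> on \<open>?b\<close> does in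
      scenario 1.\<close>
    have "x + x = y"
      by (simp add: x_def)
    show False
    proof (cases "A ?L' = ?a")
      case U: True
      show False
        using final[of 2 ?a] a U False Va cu split units[OF a] \<open>x + x = y\<close>
        by (auto simp: responses_def jobs)
    next
      case U: False
      then have "A ?L' = ?b"
        using False Um a b by auto
      then show False
        using final[of 1 ?b] b False Va cu split units[OF b] by (auto simp: responses_def jobs)
    qed
  qed
qed

end
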